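(* Let $f(x)=\sum_{e\in E} f_e(x_e)$ be a sparse separable cost function on $X\subseteq\mathbb{R}^n$ satisfying the standing assumptions listed in the context (convexity of each $f_e$, Lipschitz gradient with constant $L$, strong convexity with modulus $c$, bound $M$ on the $G_e$), with hypergraph statistics $\Omega,\Delta,\rho$, and let $(x_j)_{j\ge 0}$ be generated by the asynchronous (stale-gradient) stochastic update $$x_{j+1}=x_j-\gamma\,|e_j|\,\mathcal{P}_{v_j}G_{e_j}(x_{k(j)})$$ described in the context, with constant stepsize $\gamma$. Suppose that the lag between when a gradient is computed and when it is used in step $j$, namely $j-k(j)$, is always less than or equal to $\tau$, and that $\gamma$ is $$\gamma=\frac{\vartheta\,\epsilon\, c}{2LM^2\Omega\left(1+6\rho\tau+4\tau^2\Omega\Delta^{1/2}\right)}$$ for some $\epsilon>0$ and $\vartheta\in(0,1)$. Define $D_0:=\|x_0-x_\star\|^2$ and let $k$ be an integer satisfying $$k\ \ge\ \frac{2LM^2\Omega\left(1+6\tau\rho+6\tau^2\Omega\Delta^{1/2}\right)\log(LD_0/\epsilon)}{c^2\,\vartheta\,\epsilon}.$$ Then after $k$ component updates of $x$, we have $\mathbb{E}[f(x_k)-f_\star]\le\epsilon$.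
   Context: **Cost function.** $E$ is a finite collection of nonempty subsets $e\subseteq\{1,\dots,n\}$ (the hyperedges of a hypergraph on the nodes $\{1,\dots,n\}$). For $x\in\mathbb{R}^n$, $x_e$ denotes the values of $x$ on the coordinates indexed by $e$. The function $f:X\subseteq\mathbb{R}^n\to\mathbb{R}$ has the form $f(x)=\sum_{e\in E}f_e(x_e)$; each $f_e$ is regarded as a function of $x$ by ignoring the components not in $e$. **Hypergraph statistics.** $$\Omega:=\max_{e\in E}|e|,\qquad \Delta:=\frac{\max_{1\le v\le n}|\{e\in E: v\in e\}|}{|E|},\qquad \rho:=\frac{\max_{e\in E}|\{\hat e\in E:\hat e\cap e\neq\emptyset\}|}{|E|}.$$ **Gradients.** For each $e\in E$, $G_e(x)\in\mathbb{R}^n$ is $|E|$ times a gradient or subgradient of $f_e$ at $x$, i.e. $|E|^{-1}G_e(x)\in\partial f_e(x)$. $G_e(x)$ depends only on $x_e$ and is zero on the components not in $e$. **Standing assumptions** ($\|\cdot\|$ is the Euclidean norm). 1. Each $f_e$ is convex. 2. $f$ is continuously differentiable with Lipschitz gradient: $\|\nabla f(x')-\nabla f(x)\|\le L\|x'-x\|$ for all $x,x'\in X$. 3. $f$ is strongly convex with modulus $c>0$: $f(x')\ge f(x)+(x'-x)^T\nabla f(x)+\frac c2\|x'-x\|^2$ for all $x,x'\in X$. Let $x_\star$ be the unique minimizer of $f$ and $f_\star=f(x_\star)$. 4. There is a constant $M$ with $\|G_e(x_e)\|_2\le M$ almost surely (over the choice of $e$) for all $x\in X$. 5. $\gamma c<1$.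 **Update scheme.** $\mathcal{P}_v$ is the Euclidean projection matrix onto the $v$th coordinate (a diagonal matrix with $1$ in the $v$th diagonal position and zeros elsewhere). At each step $j=0,1,2,\dots$, a hyperedge $e_j$ is sampled uniformly at random from $E$, and then a component $v_j\in e_j$ is sampled uniformly at random from $e_j$; the samples at different steps are independent. With $x_0\in X$ the starting point, the update is $x_{j+1}=x_j-\gamma|e_j|\mathcal{P}_{v_j}G_{e_j}(x_{k(j)})$, where $\gamma$ is a fixed stepsize and $k(j)\le j$ is the index of the (possibly stale) state of the decision variable at which the gradient used in step $j$ was evaluated. Thus $x_l$ depends only on $e_0,v_0,\dots,e_{l-1},v_{l-1}$, and $x_{k(j)}$ is independent of $(e_i,v_i)$ for $i\ge k(j)$. The iterates are taken to lie in $X$. The number of "component updates" is the index $j$ of $x_j$. $\mathbb{E}$ is expectation over all the random samples.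
   Formalization: The minimizer x⋆ is additionally assumed to lie in the interior of X (automatic when X is open); if x⋆ is on the boundary the gradient there need not vanish and the claim can fail, e.g. f(x)=x²/2+bx on [0,R] with b large. *)

theory Defs
  imports "HOL-Probability.Probability"
begin

text \<open>
  Nodes are the elements of a finite type \<open>'n\<close> (so \<open>n = CARD('n)\<close> and \<open>\<real>\<^sup>n\<close> is \<^typ>\<open>real ^ 'n\<close>);
  a hypergraph is its set \<open>E :: 'n set set\<close> of hyperedges.
\<close>

definition hyp_Omega :: "('n::finite) set set \<Rightarrow> nat" where
  "hyp_Omega E = (MAX e\<in>E. card e)"

definition hyp_Delta :: "('n::finite) set set \<Rightarrow> real" where
  "hyp_Delta E = real (MAX v\<in>UNIV. card {e \<in> E. v \<in> e}) / real (card E)"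

definition hyp_rho :: "('n::finite) set set \<Rightarrow> real" where
  "hyp_rho E = real (MAX e\<in>E. card {e' \<in> E. e' \<inter> e \<noteq> {}}) / real (card E)"

text \<open>The subdifferential at \<open>x\<close> of a function \<open>h\<close> with domain \<open>X\<close>: only points of \<open>X\<close> are tested.\<close>

definition subdifferential :: "'a::real_inner set \<Rightarrow> ('a \<Rightarrow> real) \<Rightarrow> 'a \<Rightarrow> 'a set" where
  "subdifferential X h x = {g. \<forall>y\<in>X. h y \<ge> h x + g \<bullet> (y - x)}"

text \<open>
  A function on \<open>X\<close> depends only on the coordinates in \<open>e\<close>.  This is how \<open>f\<^sub>e(x\<^sub>e)\<close> is rendered:
  as a function of the full vector \<open>x\<close> that ignores the components not in \<open>e\<close>.
\<close>

definition depends_only_on :: "(real ^ 'n) set \<Rightarrow> 'n set \<Rightarrow> (real ^ 'n \<Rightarrow> 'b) \<Rightarrow> bool" where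
  "depends_only_on X e h \<longleftrightarrow>
     (\<forall>x\<in>X. \<forall>y\<in>X. (\<forall>v\<in>e. x $ v = y $ v) \<longrightarrow> h x = h y)"

definition coord_proj :: "'n \<Rightarrow> real ^ 'n ^ 'n" where
  "coord_proj v = (\<chi> i j. if i = v \<and> j = v then 1 else 0)"

text \<open>Law of one sample: a uniform hyperedge \<open>e \<in> E\<close>, then a uniform component \<open>v \<in> e\<close>.\<close>

definition sample_pmf :: "'n set set \<Rightarrow> ('n set \<times> 'n) pmf" where
  "sample_pmf E = bind_pmf (pmf_of_set E) (\<lambda>e. map_pmf (\<lambda>v. (e, v)) (pmf_of_set e))"

end

theory Submission
  imports Defs
begin

text \<open>
  Write \<open>g(y)\<close> for the mean of \<open>G\<^sub>e(y)\<close> over a uniform hyperedge \<open>e\<close>, \<open>y\<close> for the stale point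
  \<open>x\<^sub>k\<^sub>(\<^sub>j\<^sub>)\<close>, and \<open>b\<^sub>j\<close> for the expectation of \<open>\<parallel>x\<^sub>j - x\<^sub>\<star>\<parallel>\<^sup>2\<close>.  The sample of step \<open>j\<close> is independent of
  \<open>x\<^sub>j\<close> and \<open>y\<close>, and the weighted sampled component is an unbiased estimate of \<open>g(y)\<close> with second
  moment at most \<open>\<Omega> M\<^sup>2\<close> (\<open>expectation_fresh_sample\<close>, \<open>expected_squared_distance_after_step\<close>), so
  \<open>b\<^sub>j\<^sub>+\<^sub>1\<close> is at most the expectation of
  \<open>\<parallel>x\<^sub>j - x\<^sub>\<star>\<parallel>\<^sup>2 - 2 \<gamma> (x\<^sub>j - x\<^sub>\<star>) \<bullet> g(y) + \<gamma>\<^sup>2 \<Omega> M\<^sup>2\<close>.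

  The lag is controlled along every path, without further use of independence.  Each step changes one
  coordinate by at most \<open>\<gamma> \<Omega> M\<close>, so \<open>x\<^sub>j - y\<close> has \<open>\<ell>\<^sub>1\<close> norm at most \<open>\<gamma> \<tau> \<Omega> M\<close>
  (\<open>l1_displacement_bound\<close>).  Each coordinate of \<open>g(y)\<close> is at most \<open>M \<Delta>\<close>, because a node lies in at most
  \<open>\<Delta> |E|\<close> hyperedges (\<open>edge_mean_component_bound\<close>).  Hence replacing \<open>x\<^sub>j\<close> by \<open>y\<close> in the inner product
  costs at most \<open>\<gamma> \<tau> \<Omega> M\<^sup>2 \<Delta>\<close>.  Strong convexity gives \<open>(y - x\<^sub>\<star>) \<bullet> g(y) \<ge> c \<parallel>y - x\<^sub>\<star>\<parallel>\<^sup>2\<close>; half of this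
  modulus is given up to pass from \<open>\<parallel>y - x\<^sub>\<star>\<parallel>\<^sup>2\<close> back to \<open>\<parallel>x\<^sub>j - x\<^sub>\<star>\<parallel>\<^sup>2\<close>.  The result
  (\<open>stale_step_contraction\<close>) is \<open>b\<^sub>j\<^sub>+\<^sub>1 \<le> (1 - \<gamma> c) b\<^sub>j + \<gamma>\<^sup>2 N\<close> with
  \<open>N = \<Omega> M\<^sup>2 (1 + 2 \<tau> \<Delta>) + 2 \<gamma> c \<tau>\<^sup>2 \<Omega>\<^sup>2 M\<^sup>2\<close>.

  The last term of \<open>N\<close> carries no factor \<open>\<Delta>\<close> by itself.  The same coordinate bound gives
  \<open>c\<^sup>2 \<parallel>y - x\<^sub>\<star>\<parallel>\<^sup>2 \<le> \<parallel>g(y)\<parallel>\<^sup>2 \<le> \<Omega> M\<^sup>2 \<Delta>\<close> on all of \<open>X\<close> (\<open>norm_edge_mean_bound\<close>).  So either \<open>\<epsilon>\<close> is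
  so large that \<open>f - f\<^sub>\<star> \<le> \<epsilon>\<close> everywhere on \<open>X\<close>, or \<open>\<epsilon>\<close>, and with it \<open>\<gamma>\<close>, is so small that
  \<open>\<gamma> c \<le> \<Delta> / 4\<close>.  In the second case, as \<open>\<Delta> \<le> \<rho>\<close> and \<open>\<Delta> \<le> \<Delta>\<^sup>1\<^sup>/\<^sup>2\<close>, \<open>N\<close> is at most \<open>\<Omega> M\<^sup>2\<close> times
  the bracket in the denominator of \<open>\<gamma>\<close>.  The recursion then gives
  \<open>L b\<^sub>k / 2 \<le> (1 - \<gamma> c)\<^sup>k L D\<^sub>0 / 2 + \<epsilon> / 4\<close>, the number of steps makes the first term at most
  \<open>\<epsilon> / 2\<close>, and smoothness bounds the expected value gap by \<open>L b\<^sub>k / 2\<close>.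
\<close>

section \<open>Strong convexity and smoothness on a convex domain\<close>

lemma strongly_convex_on_segment:
  fixes f :: "'a::real_inner \<Rightarrow> real"
  assumes "convex X" and y: "y \<in> X" and z: "z \<in> X" and t: "0 \<le> t" "t \<le> 1"
    and sc: "\<And>a b. a \<in> X \<Longrightarrow> b \<in> X \<Longrightarrow>
      f b \<ge> f a + (b - a) \<bullet> g a + c / 2 * (norm (b - a))\<^sup>2"
  shows "f (y + t *\<^sub>R (z - y)) \<le> (1 - t) * f y + t * f z - c / 2 * t * (1 - t) * (norm (z - y))\<^sup>2"
proof -
  define w where "w = y + t *\<^sub>R (z - y)"
  have w: "w \<in> X"
    using convexD_alt[OF assms(1) y z t] unfolding w_def by (simp add: algebra_simps)
  have dy: "y - w = (- t) *\<^sub>R (z - y)" and dz: "z - w = (1 - t) *\<^sub>R (z - y)"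
    unfolding w_def by (simp_all add: algebra_simps)
  define N s where "N = (norm (z - y))\<^sup>2" and "s = (z - y) \<bullet> g w"
  have "(1 - t) * f y \<ge> (1 - t) * (f w - t * s + c / 2 * (t\<^sup>2 * N))"
    using sc[OF w y] t unfolding dy N_def s_def by (intro mult_left_mono) (simp_all add: power_mult_distrib)
  moreover have "t * f z \<ge>
      t * (f w + (1 - t) * s + c / 2 * ((1 - t)\<^sup>2 * N))"
    using sc[OF w z] t unfolding dz N_def s_def by (intro mult_left_mono) (simp_all add: power_mult_distrib)
  moreover have "(1 - t) * (f w - t * s + c / 2 * (t\<^sup>2 * N)) + t * (f w + (1 - t) * s + c / 2 * ((1 - t)\<^sup>2 * N))
      = f w + c / 2 * t * (1 - t) * N"
    by (simp add: field_simps power2_eq_square)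
  ultimately show ?thesis
    unfolding w_def[symmetric] N_def[symmetric] by linarith
qed

text \<open>
  A subgradient relative to \<open>X\<close> need not be the gradient at boundary points of \<open>X\<close>, but it satisfies
  the same strong convexity inequality, since strong convexity is also an inequality between
  function values on segments.
\<close>

lemma strongly_convex_subgradient:
  fixes f :: "'a::real_inner \<Rightarrow> real"
  assumes "convex X" and y: "y \<in> X" and z: "z \<in> X"
    and sc: "\<And>a b. a \<in> X \<Longrightarrow> b \<in> X \<Longrightarrow>
      f b \<ge> f a + (b - a) \<bullet> g a + c / 2 * (norm (b - a))\<^sup>2"
    and p: "p \<in> subdifferential X f y"
  shows "f z \<ge> f y + p \<bullet> (z - y) + c / 2 * (norm (z - y))\<^sup>2"
proof -
  define N where "N = (norm (z - y))\<^sup>2"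
  have le: "p \<bullet> (z - y) \<le> f z - f y - c / 2 * (1 - t) * N" if t: "0 < t" "t < 1" for t
  proof -
    have "y + t *\<^sub>R (z - y) \<in> X"
      using convexD_alt[OF assms(1) y z, of t] t by (simp add: algebra_simps)
    then have "f y + t * (p \<bullet> (z - y)) \<le> f (y + t *\<^sub>R (z - y))"
      using p unfolding subdifferential_def by fastforce
    also have "\<dots> \<le> (1 - t) * f y + t * f z - c / 2 * t * (1 - t) * N"
      unfolding N_def using t by (intro strongly_convex_on_segment[OF assms(1) y z _ _ sc]) auto
    finally have "t * (p \<bullet> (z - y)) \<le> t * (f z - f y - c / 2 * (1 - t) * N)"
      by (simp add: algebra_simps)
    then show ?thesis using t by simp
  qed
  have "((\<lambda>t. f z - f y - c / 2 * (1 - t) * N) \<longlongrightarrow> f z - f y - c / 2 * (1 - 0) * N) (at_right 0)"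
    by (intro tendsto_intros)
  moreover have "\<forall>\<^sub>F t in at_right 0. p \<bullet> (z - y) \<le> f z - f y - c / 2 * (1 - t) * N"
    unfolding eventually_at_right_field using le by (intro exI[of _ 1]) auto
  ultimately have "p \<bullet> (z - y) \<le> f z - f y - c / 2 * (1 - 0) * N"
    by (intro tendsto_lowerbound) auto
  then show ?thesis unfolding N_def by simp
qed

lemma gradient_zero_at_interior_minimizer:
  fixes f :: "'a::euclidean_space \<Rightarrow> real"
  assumes "is_arg_min f (\<lambda>y. y \<in> X) z" and z: "z \<in> interior X"
    and "(f has_derivative (\<lambda>h. g \<bullet> h)) (at z within X)"
  shows "g = 0"
proof -
  have "(f has_derivative (\<lambda>h. g \<bullet> h)) (at z)"
    using assms(3) at_within_interior[OF z] by simp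
  moreover have "\<forall>y\<in>interior X. f z \<le> f y"
    using assms(1) interior_subset unfolding is_arg_min_linorder by blast
  ultimately have "(\<lambda>h. g \<bullet> h) = (\<lambda>h. 0)"
    using differential_zero_maxmin[OF z open_interior] by blast
  then show ?thesis by (metis inner_eq_zero_iff)
qed

lemma lipschitz_gradient_upper_bound:
  fixes f :: "'a::real_inner \<Rightarrow> real"
  assumes "convex X" and z: "z \<in> X" and y: "y \<in> X"
    and der: "\<And>a. a \<in> X \<Longrightarrow> (f has_derivative (\<lambda>h. g a \<bullet> h)) (at a within X)"
    and lip: "\<And>a. a \<in> X \<Longrightarrow> norm (g a - g z) \<le> L * norm (a - z)"
  shows "f y \<le> f z + g z \<bullet> (y - z) + L / 2 * (norm (y - z))\<^sup>2"
proof -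
  define d where "d = y - z"
  define \<phi> where "\<phi> = (\<lambda>t. f (z + t *\<^sub>R d) - t * (g z \<bullet> d) - L / 2 * t\<^sup>2 * (norm d)\<^sup>2)"
  have mem: "z + t *\<^sub>R d \<in> X" if "0 \<le> t" "t \<le> 1" for t
    using convexD_alt[OF assms(1) z y that] unfolding d_def by (simp add: algebra_simps)
  have "\<exists>t\<in>{0<..<1}. \<phi> 1 - \<phi> 0 =
      (\<lambda>h. g (z + t *\<^sub>R d) \<bullet> (h *\<^sub>R d) - h * (g z \<bullet> d) - L * t * h * (norm d)\<^sup>2) (1 - 0)"
  proof (rule mvt_simple)
    fix t :: real assume "0 \<le> t" "t \<le> 1"
    have "((\<lambda>t. z + t *\<^sub>R d) has_derivative (\<lambda>h. h *\<^sub>R d)) (at t within {0..1})"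
      by (auto intro!: derivative_eq_intros)
    moreover have "(f has_derivative (\<lambda>h. g (z + t *\<^sub>R d) \<bullet> h))
        (at (z + t *\<^sub>R d) within (\<lambda>t. z + t *\<^sub>R d) ` {0..1})"
      using mem \<open>0 \<le> t\<close> \<open>t \<le> 1\<close> by (intro has_derivative_subset[OF der]) auto
    ultimately have "((\<lambda>t. f (z + t *\<^sub>R d)) has_derivative (\<lambda>h. g (z + t *\<^sub>R d) \<bullet> (h *\<^sub>R d)))
        (at t within {0..1})"
      by (rule has_derivative_in_compose)
    then show "(\<phi> has_derivative
        (\<lambda>h. g (z + t *\<^sub>R d) \<bullet> (h *\<^sub>R d) - h * (g z \<bullet> d) - L * t * h * (norm d)\<^sup>2)) (at t within {0..1})"
      unfolding \<phi>_def by (auto intro!: derivative_eq_intros simp: algebra_simps)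
  qed simp
  then obtain t where t: "0 < t" "t < 1"
    and eq: "\<phi> 1 - \<phi> 0 = (g (z + t *\<^sub>R d) - g z) \<bullet> d - L * t * (norm d)\<^sup>2"
    by (auto simp: inner_diff_left)
  have "(g (z + t *\<^sub>R d) - g z) \<bullet> d \<le> norm (g (z + t *\<^sub>R d) - g z) * norm d"
    by (rule norm_cauchy_schwarz)
  also have "\<dots> \<le> L * norm (t *\<^sub>R d) * norm d"
    using lip[OF mem[of t]] t by (intro mult_right_mono) auto
  also have "\<dots> = L * t * (norm d)\<^sup>2"
    using t by (simp add: power2_eq_square)
  finally show ?thesis
    using eq unfolding \<phi>_def d_def by simp
qed

section \<open>Hypergraph statistics\<close>

lemma card_le_hyp_Omega:
  assumes "e \<in> E" shows "card e \<le> hyp_Omega E"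
  unfolding hyp_Omega_def using assms by (intro Max_ge) auto

lemma degree_le_hyp_Delta:
  assumes "E \<noteq> {}" shows "real (card {e \<in> E. v \<in> e}) \<le> hyp_Delta E * real (card E)"
proof -
  have "card {e \<in> E. v \<in> e} \<le> (MAX v\<in>UNIV. card {e \<in> E. v \<in> e})"
    by (intro Max_ge) auto
  then show ?thesis
    using assms unfolding hyp_Delta_def by (simp add: card_gt_0_iff)
qed

lemma hyp_Delta_nonneg: "0 \<le> hyp_Delta E"
  unfolding hyp_Delta_def by simp

lemma hyp_Delta_attained:
  obtains v where "hyp_Delta E = real (card {e \<in> E. v \<in> e}) / real (card E)"
proof -
  have "(MAX v\<in>UNIV. card {e \<in> E. v \<in> e}) \<in> range (\<lambda>v. card {e \<in> E. v \<in> e})"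
    by (intro Max_in) auto
  then obtain v where "(MAX v\<in>UNIV. card {e \<in> E. v \<in> e}) = card {e \<in> E. v \<in> e}"
    by (rule imageE)
  then show ?thesis
    by (intro that[of v]) (simp only: hyp_Delta_def)
qed

lemma hyp_Delta_le_1: "hyp_Delta E \<le> 1"
proof -
  obtain v where "hyp_Delta E = real (card {e \<in> E. v \<in> e}) / real (card E)"
    by (rule hyp_Delta_attained)
  moreover have "card {e \<in> E. v \<in> e} \<le> card E"
    by (intro card_mono) auto
  ultimately show ?thesis
    by (simp add: divide_le_eq_1 card_gt_0_iff)
qed

text \<open>A hyperedge through a node of maximal degree meets every hyperedge through that node.\<close>

lemma hyp_Delta_le_hyp_rho: "hyp_Delta E \<le> hyp_rho E"
proof -
  obtain v where v: "hyp_Delta E = real (card {e \<in> E. v \<in> e}) / real (card E)"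
    by (rule hyp_Delta_attained)
  have "card {e \<in> E. v \<in> e} \<le> (MAX e\<in>E. card {e' \<in> E. e' \<inter> e \<noteq> {}})"
  proof (cases "\<exists>e\<in>E. v \<in> e")
    case True
    then obtain e where e: "e \<in> E" "v \<in> e" by blast
    then have "card {e \<in> E. v \<in> e} \<le> card {e' \<in> E. e' \<inter> e \<noteq> {}}"
      by (intro card_mono) auto
    also have "\<dots> \<le> (MAX e\<in>E. card {e' \<in> E. e' \<inter> e \<noteq> {}})"
      using e by (intro Max_ge) auto
    finally show ?thesis .
  next
    case False
    then have "{e \<in> E. v \<in> e} = {}" by blast
    then show ?thesis by (simp only: card.empty)
  qed
  then show ?thesis
    unfolding v hyp_rho_def by (intro divide_right_mono) auto
qed

section \<open>Edgewise vectors, their mean, and one sampled component\<close>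

text \<open>The mean of the vectors \<open>W e\<close> over a uniformly chosen hyperedge.\<close>

definition edge_mean :: "'n set set \<Rightarrow> ('n set \<Rightarrow> real ^ 'n) \<Rightarrow> real ^ 'n" where
  "edge_mean E W = (1 / real (card E)) *\<^sub>R (\<Sum>e\<in>E. W e)"

lemma edge_mean_component_bound:
  fixes E :: "('n::finite) set set"
  assumes "E \<noteq> {}" and supp: "\<And>e v. e \<in> E \<Longrightarrow> v \<notin> e \<Longrightarrow> W e $ v = 0"
    and bound: "\<And>e. e \<in> E \<Longrightarrow> norm (W e) \<le> M"
  shows "\<bar>edge_mean E W $ v\<bar> \<le> M * hyp_Delta E"
proof -
  have cE: "real (card E) > 0" using assms(1) by (simp add: card_gt_0_iff)
  have M: "M \<ge> 0" using assms(1) bound norm_ge_zero order_trans by blast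
  have "\<bar>\<Sum>e\<in>E. W e $ v\<bar> \<le> (\<Sum>e\<in>E. \<bar>W e $ v\<bar>)"
    by (rule sum_abs)
  also have "\<dots> \<le> (\<Sum>e\<in>E. if v \<in> e then M else 0)"
    using supp bound component_le_norm_cart order_trans by (intro sum_mono) fastforce
  also have "\<dots> = M * real (card {e \<in> E. v \<in> e})"
    by (simp add: sum.If_cases Int_def)
  also have "\<dots> \<le> M * (hyp_Delta E * real (card E))"
    using degree_le_hyp_Delta[OF assms(1)] M by (intro mult_left_mono)
  finally show ?thesis
    unfolding edge_mean_def using cE by (simp add: abs_mult divide_le_eq mult.assoc)
qed

lemma norm_edge_mean_bound:
  fixes E :: "('n::finite) set set"
  assumes "E \<noteq> {}" and supp: "\<And>e v. e \<in> E \<Longrightarrow> v \<notin> e \<Longrightarrow> W e $ v = 0"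
    and bound: "\<And>e. e \<in> E \<Longrightarrow> norm (W e) \<le> M"
  shows "(norm (edge_mean E W))\<^sup>2 \<le> real (hyp_Omega E) * M\<^sup>2 * hyp_Delta E"
proof -
  let ?g = "edge_mean E W"
  have cE: "real (card E) > 0" using assms(1) by (simp add: card_gt_0_iff)
  have M: "M \<ge> 0" using assms(1) bound norm_ge_zero order_trans by blast
  have edge: "W e \<bullet> ?g \<le> real (hyp_Omega E) * M\<^sup>2 * hyp_Delta E" if e: "e \<in> E" for e
  proof -
    have "W e \<bullet> ?g = (\<Sum>v\<in>e. W e $ v * ?g $ v)"
      unfolding inner_vec_def using supp[OF e] by (intro sum.mono_neutral_cong_right) auto
    also have "\<dots> \<le> (\<Sum>v\<in>e. M * (M * hyp_Delta E))"
    proof (intro sum_mono)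
      fix v
      have "W e $ v * ?g $ v \<le> \<bar>W e $ v\<bar> * \<bar>?g $ v\<bar>"
        by (metis abs_ge_self abs_mult)
      also have "\<dots> \<le> M * (M * hyp_Delta E)"
        using edge_mean_component_bound[OF assms, where v = v] bound[OF e] component_le_norm_cart[of "W e" v] M
        by (intro mult_mono) auto
      finally show "W e $ v * ?g $ v \<le> M * (M * hyp_Delta E)" .
    qed
    also have "\<dots> = real (card e) * (M\<^sup>2 * hyp_Delta E)"
      by (simp add: power2_eq_square)
    also have "\<dots> \<le> real (hyp_Omega E) * (M\<^sup>2 * hyp_Delta E)"
      using card_le_hyp_Omega[OF e] hyp_Delta_nonneg[of E] by (intro mult_right_mono) auto
    finally show ?thesis by (simp add: mult.assoc)
  qed
  have "(norm ?g)\<^sup>2 = (\<Sum>e\<in>E. W e \<bullet> ?g) / real (card E)"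
    unfolding power2_norm_eq_inner by (subst (1) edge_mean_def) (simp add: inner_sum_left)
  also have "\<dots> \<le> (\<Sum>e\<in>E. real (hyp_Omega E) * M\<^sup>2 * hyp_Delta E) / real (card E)"
    using edge by (intro divide_right_mono sum_mono) auto
  also have "\<dots> = real (hyp_Omega E) * M\<^sup>2 * hyp_Delta E"
    using assms(1) by simp
  finally show ?thesis .
qed

lemma coord_proj_mult_vec: "coord_proj v *v w = (w $ v) *\<^sub>R axis v 1"
proof -
  have "(\<Sum>j\<in>UNIV. (if i = v \<and> j = v then 1 else 0) * w $ j) = (if i = v then w $ v else 0)" for i
    by (cases "i = v") (simp_all add: if_distrib[of "\<lambda>a. a * _"] cong: if_cong)
  then show ?thesis
    unfolding coord_proj_def matrix_vector_mult_def axis_def by (simp add: vec_eq_iff)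
qed

lemma expectation_sample_pmf:
  fixes E :: "('n::finite) set set" and h :: "'n set \<times> 'n \<Rightarrow> real"
  assumes "E \<noteq> {}" "{} \<notin> E"
  shows "measure_pmf.expectation (sample_pmf E) h =
    (\<Sum>e\<in>E. (\<Sum>v\<in>e. h (e, v)) / real (card e)) / real (card E)"
proof -
  have "measure_pmf.expectation (sample_pmf E) h =
     (\<Sum>e\<in>E. measure_pmf.expectation (map_pmf (Pair e) (pmf_of_set e)) h /\<^sub>R real (card E))"
    unfolding sample_pmf_def using assms by (intro pmf_expectation_bind_pmf_of_set) auto
  also have "\<dots> = (\<Sum>e\<in>E. (\<Sum>v\<in>e. h (e, v)) / real (card e) / real (card E))"
  proof (intro sum.cong refl)
    fix e assume "e \<in> E"
    then have "e \<noteq> {}" using assms(2) by blast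
    then show "measure_pmf.expectation (map_pmf (Pair e) (pmf_of_set e)) h /\<^sub>R real (card E) =
        (\<Sum>v\<in>e. h (e, v)) / real (card e) / real (card E)"
      by (simp add: integral_pmf_of_set divide_inverse mult.commute)
  qed
  finally show ?thesis by (simp add: sum_divide_distrib)
qed

text \<open>
  Weighting the sampled component by \<open>card e\<close> makes the step unbiased; its second moment is only of
  order \<open>card e\<close>, not \<open>(card e)\<^sup>2\<close>, because \<open>v\<close> is sampled uniformly from \<open>e\<close>.
\<close>

lemma expected_squared_distance_after_step:
  fixes E :: "('n::finite) set set" and u :: "real ^ 'n"
  assumes E: "E \<noteq> {}" "{} \<notin> E" and supp: "\<And>e v. e \<in> E \<Longrightarrow> v \<notin> e \<Longrightarrow> W e $ v = 0"
    and bound: "\<And>e. e \<in> E \<Longrightarrow> norm (W e) \<le> M"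
  shows "measure_pmf.expectation (sample_pmf E)
      (\<lambda>(e, v). (norm (u - (\<gamma> * real (card e)) *\<^sub>R (coord_proj v *v W e)))\<^sup>2)
    \<le> (norm u)\<^sup>2 - 2 * \<gamma> * (u \<bullet> edge_mean E W) + \<gamma>\<^sup>2 * (real (hyp_Omega E) * M\<^sup>2)"
proof -
  have cE: "real (card E) > 0" using E(1) by (simp add: card_gt_0_iff)
  have edge: "(\<Sum>v\<in>e. (norm (u - (\<gamma> * real (card e)) *\<^sub>R (coord_proj v *v W e)))\<^sup>2) / real (card e)
      \<le> (norm u)\<^sup>2 - 2 * \<gamma> * (u \<bullet> W e) + \<gamma>\<^sup>2 * (real (hyp_Omega E) * M\<^sup>2)" if e: "e \<in> E" for e
  proof -
    have ne: "e \<noteq> {}" using e E(2) by blast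
    have sq: "(norm (u - (\<gamma> * real (card e)) *\<^sub>R (coord_proj v *v W e)))\<^sup>2 =
        (norm u)\<^sup>2 - 2 * \<gamma> * real (card e) * (u $ v * W e $ v)
        + \<gamma>\<^sup>2 * (real (card e))\<^sup>2 * (W e $ v * W e $ v)" for v
      unfolding coord_proj_mult_vec power2_norm_eq_inner
      by (simp add: inner_diff_left inner_diff_right inner_axis inner_axis' power2_eq_square algebra_simps)
    have inner: "a \<bullet> W e = (\<Sum>v\<in>e. a $ v * W e $ v)" for a
      unfolding inner_vec_def using supp[OF e] by (intro sum.mono_neutral_cong_right) auto
    have "(\<Sum>v\<in>e. (norm (u - (\<gamma> * real (card e)) *\<^sub>R (coord_proj v *v W e)))\<^sup>2) =
        real (card e) * (norm u)\<^sup>2 - 2 * \<gamma> * real (card e) * (u \<bullet> W e)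
        + \<gamma>\<^sup>2 * (real (card e))\<^sup>2 * (W e \<bullet> W e)"
      unfolding sq inner by (simp add: sum.distrib sum_subtractf sum_distrib_left)
    also have "\<dots> / real (card e) =
        (norm u)\<^sup>2 - 2 * \<gamma> * (u \<bullet> W e) + \<gamma>\<^sup>2 * (real (card e) * (norm (W e))\<^sup>2)"
      using ne
      by (simp add: add_divide_distrib diff_divide_distrib power2_eq_square[of "real (card e)"]
        power2_norm_eq_inner)
    also have "\<dots> \<le> (norm u)\<^sup>2 - 2 * \<gamma> * (u \<bullet> W e) + \<gamma>\<^sup>2 * (real (hyp_Omega E) * M\<^sup>2)"
      using card_le_hyp_Omega[OF e] bound[OF e] by (intro add_left_mono mult_left_mono mult_mono power_mono) auto
    finally show ?thesis .
  qed
  have "measure_pmf.expectation (sample_pmf E)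
      (\<lambda>(e, v). (norm (u - (\<gamma> * real (card e)) *\<^sub>R (coord_proj v *v W e)))\<^sup>2) =
      (\<Sum>e\<in>E. (\<Sum>v\<in>e. (norm (u - (\<gamma> * real (card e)) *\<^sub>R (coord_proj v *v W e)))\<^sup>2) / real (card e))
        / real (card E)"
    by (simp add: expectation_sample_pmf[OF E])
  also have "\<dots> \<le> (\<Sum>e\<in>E. (norm u)\<^sup>2 - 2 * \<gamma> * (u \<bullet> W e) + \<gamma>\<^sup>2 * (real (hyp_Omega E) * M\<^sup>2))
      / real (card E)"
    using edge by (intro divide_right_mono sum_mono) auto
  also have "\<dots> = (norm u)\<^sup>2 - 2 * \<gamma> * (u \<bullet> edge_mean E W) + \<gamma>\<^sup>2 * (real (hyp_Omega E) * M\<^sup>2)"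
    unfolding edge_mean_def using E(1)
    by (simp add: sum.distrib sum_subtractf inner_sum_right sum_distrib_left add_divide_distrib
        diff_divide_distrib sum_divide_distrib)
  finally show ?thesis .
qed

lemma edge_mean_subgradient:
  assumes "\<And>z. z \<in> X \<Longrightarrow> f z = (\<Sum>e\<in>E. h e z)" and "y \<in> X"
    and "\<And>e. e \<in> E \<Longrightarrow> (1 / real (card E)) *\<^sub>R W e \<in> subdifferential X (h e) y"
  shows "edge_mean E W \<in> subdifferential X f y"
  unfolding subdifferential_def
proof (intro CollectI ballI)
  fix z assume z: "z \<in> X"
  have "f y + edge_mean E W \<bullet> (z - y) = (\<Sum>e\<in>E. h e y + ((1 / real (card E)) *\<^sub>R W e) \<bullet> (z - y))"
    unfolding edge_mean_def assms(1)[OF \<open>y \<in> X\<close>]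
    by (simp add: sum.distrib inner_sum_left sum_divide_distrib)
  also have "\<dots> \<le> (\<Sum>e\<in>E. h e z)"
    using assms(3) z unfolding subdifferential_def by (intro sum_mono) auto
  finally show "f y + edge_mean E W \<bullet> (z - y) \<le> f z"
    using assms(1)[OF z] by simp
qed

text \<open>
  A sampled step changes one coordinate, by at most \<open>\<gamma> * hyp_Omega E * M\<close>.  Hence the displacement
  over a number of steps is controlled in the \<open>\<ell>\<^sub>1\<close> norm along every path, which pairs with the
  bound on the components of the mean gradient.
\<close>

lemma l1_displacement_bound:
  fixes x :: "nat \<Rightarrow> real ^ 'n"
  assumes upd: "\<And>l. x (Suc l) = x l - (\<gamma> * real (card (e l))) *\<^sub>R (coord_proj (v l) *v W l)"
    and e: "\<And>l. e l \<in> E" and W: "\<And>l. norm (W l) \<le> M" and \<gamma>: "0 \<le> \<gamma>" and "i \<le> j"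
  shows "(\<Sum>a\<in>UNIV. \<bar>(x j - x i) $ a\<bar>) \<le> \<gamma> * real (j - i) * (real (hyp_Omega E) * M)"
  using \<open>i \<le> j\<close>
proof (induction j rule: dec_induct)
  case base
  then show ?case by simp
next
  case (step j)
  define s where "s = \<gamma> * real (card (e j)) * W j $ v j"
  have M: "M \<ge> 0" using W[of j] norm_ge_zero order_trans by blast
  have "real (card (e j)) * \<bar>W j $ v j\<bar> \<le> real (hyp_Omega E) * M"
    using card_le_hyp_Omega[OF e[of j]] component_le_norm_cart[of "W j" "v j"] W[of j] M
    by (intro mult_mono) auto
  then have s: "\<bar>s\<bar> \<le> \<gamma> * (real (hyp_Omega E) * M)"
    unfolding s_def using \<gamma> by (simp add: abs_mult mult.assoc mult_left_mono)
  have "(x (Suc j) - x i) $ a = (x j - x i) $ a - (if a = v j then s else 0)" for a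
    unfolding upd coord_proj_mult_vec s_def by (simp add: axis_def)
  then have "(\<Sum>a\<in>UNIV. \<bar>(x (Suc j) - x i) $ a\<bar>) \<le>
      (\<Sum>a\<in>UNIV. \<bar>(x j - x i) $ a\<bar> + (if a = v j then \<bar>s\<bar> else 0))"
    by (intro sum_mono) auto
  also have "\<dots> = (\<Sum>a\<in>UNIV. \<bar>(x j - x i) $ a\<bar>) + \<bar>s\<bar>"
    by (simp add: sum.distrib)
  also have "\<dots> \<le> \<gamma> * real (j - i) * (real (hyp_Omega E) * M) + \<gamma> * (real (hyp_Omega E) * M)"
    using step.IH s by (rule add_mono)
  also have "\<dots> = \<gamma> * real (Suc j - i) * (real (hyp_Omega E) * M)"
    using step.hyps by (simp add: Suc_diff_le algebra_simps)
  finally show ?case .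
qed

section \<open>Random variables determined by the first samples\<close>

text \<open>
  On \<open>space M\<close>, the value of \<open>D\<close> is a function of the samples \<open>S 0, \<dots>, S (j - 1)\<close>.  For samples in a
  finite type such a \<open>D\<close> takes finitely many values, so no measurability of the functions that
  generate it is needed.
\<close>

definition determined_by :: "'a measure \<Rightarrow> (nat \<Rightarrow> 'a \<Rightarrow> 's) \<Rightarrow> nat \<Rightarrow> ('a \<Rightarrow> 'd) \<Rightarrow> bool" where
  "determined_by M S j D \<longleftrightarrow>
     (\<forall>\<omega>\<in>space M. \<forall>\<omega>'\<in>space M. (\<forall>i<j. S i \<omega> = S i \<omega>') \<longrightarrow> D \<omega> = D \<omega>')"

lemma determined_by_comp: "determined_by M S j D \<Longrightarrow> determined_by M S j (\<lambda>\<omega>. F (D \<omega>))"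
  unfolding determined_by_def by metis

lemma determined_by_mono: "i \<le> j \<Longrightarrow> determined_by M S i D \<Longrightarrow> determined_by M S j D"
  unfolding determined_by_def by (meson order_less_le_trans)

lemma determined_by_Pair:
  "determined_by M S j C \<Longrightarrow> determined_by M S j D \<Longrightarrow> determined_by M S j (\<lambda>\<omega>. (C \<omega>, D \<omega>))"
  unfolding determined_by_def by blast

lemma determined_by_factor:
  assumes "determined_by M S j D"
  obtains h where "\<And>\<omega>. \<omega> \<in> space M \<Longrightarrow> D \<omega> = h (restrict (\<lambda>i. S i \<omega>) {..<j})"
proof
  define h where "h a = D (SOME \<omega>. \<omega> \<in> space M \<and> restrict (\<lambda>i. S i \<omega>) {..<j} = a)" for a
  fix \<omega> assume \<omega>: "\<omega> \<in> space M"
  define \<omega>' where "\<omega>' = (SOME \<omega>'. \<omega>' \<in> space M \<and>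
    restrict (\<lambda>i. S i \<omega>') {..<j} = restrict (\<lambda>i. S i \<omega>) {..<j})"
  have "\<omega>' \<in> space M \<and> restrict (\<lambda>i. S i \<omega>') {..<j} = restrict (\<lambda>i. S i \<omega>) {..<j}"
    unfolding \<omega>'_def by (rule someI[of _ \<omega>]) (use \<omega> in simp)
  then have "\<omega>' \<in> space M" and "S i \<omega> = S i \<omega>'" if "i < j" for i
    using that by (auto dest: fun_cong[of _ _ i])
  then have "D \<omega> = D \<omega>'"
    using assms \<omega> \<open>\<omega>' \<in> space M \<and> _\<close> unfolding determined_by_def by metis
  then show "D \<omega> = h (restrict (\<lambda>i. S i \<omega>) {..<j})"
    unfolding h_def \<omega>'_def .
qed

lemma PiM_count_space_UNIV:
  "PiM {..<j::nat} (\<lambda>_. count_space (UNIV :: 's::finite set)) = count_space (PiE {..<j} (\<lambda>_. UNIV))"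
  by (rule count_space_PiM_finite) auto

lemma (in prob_space) integrable_determined_by:
  fixes S :: "nat \<Rightarrow> 'a \<Rightarrow> 's::finite" and Z :: "'a \<Rightarrow> real"
  assumes S: "\<And>i. S i \<in> measurable M (count_space UNIV)" and "determined_by M S j Z"
  shows "integrable M Z"
proof -
  obtain h where h: "\<And>\<omega>. \<omega> \<in> space M \<Longrightarrow> Z \<omega> = h (restrict (\<lambda>i. S i \<omega>) {..<j})"
    using assms(2) by (rule determined_by_factor) blast
  have "(\<lambda>\<omega>. restrict (\<lambda>i. S i \<omega>) {..<j}) \<in> measurable M (PiM {..<j} (\<lambda>_. count_space UNIV))"
    using S by (intro measurable_restrict)
  then have meas: "(\<lambda>\<omega>. h (restrict (\<lambda>i. S i \<omega>) {..<j})) \<in> borel_measurable M"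
    unfolding PiM_count_space_UNIV by (rule measurable_compose) simp
  have fin: "finite (PiE {..<j} (\<lambda>_. UNIV :: 's set))"
    by (intro finite_PiE) auto
  have "integrable M (\<lambda>\<omega>. h (restrict (\<lambda>i. S i \<omega>) {..<j}))"
  proof (rule integrable_const_bound[OF _ meas])
    have "restrict (\<lambda>i. S i \<omega>) {..<j} \<in> PiE {..<j} (\<lambda>_. UNIV)" for \<omega>
      by (rule restrict_PiE_iff[THEN iffD2]) simp
    then have "norm (h (restrict (\<lambda>i. S i \<omega>) {..<j})) \<le> (\<Sum>a\<in>PiE {..<j} (\<lambda>_. UNIV). norm (h a))" for \<omega>
      by (rule member_le_sum[where f = "\<lambda>a. norm (h a)"]) (use fin in auto)
    then show "AE \<omega> in M. norm (h (restrict (\<lambda>i. S i \<omega>) {..<j})) \<le>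
        (\<Sum>a\<in>PiE {..<j} (\<lambda>_. UNIV). norm (h a))"
      by simp
  qed
  then show ?thesis
    using h Bochner_Integration.integrable_cong[OF refl, of M Z "\<lambda>\<omega>. h (restrict (\<lambda>i. S i \<omega>) {..<j})"] by simp
qed

text \<open>The tower rule for a sample that is independent of the past.\<close>

lemma (in prob_space) expectation_fresh_sample:
  fixes S :: "nat \<Rightarrow> 'a \<Rightarrow> 's::finite" and \<psi> :: "'d \<Rightarrow> 's \<Rightarrow> real"
  assumes ind: "indep_vars (\<lambda>_. count_space UNIV) S UNIV"
    and law: "distr M (count_space UNIV) (S j) = measure_pmf p"
    and det: "determined_by M S j D"
  shows "expectation (\<lambda>\<omega>. \<psi> (D \<omega>) (S j \<omega>)) =
    expectation (\<lambda>\<omega>. measure_pmf.expectation p (\<psi> (D \<omega>)))"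
proof -
  have S: "S i \<in> measurable M (count_space UNIV)" for i
    using ind unfolding indep_vars_def by auto
  have int_past: "integrable M (\<lambda>\<omega>. \<psi> (D \<omega>) b)" for b
    by (rule integrable_determined_by[OF S determined_by_comp[OF det]])
  have int_ind: "integrable M (\<lambda>\<omega>. indicator {b} (S j \<omega>) :: real)" for b
    by (rule integrable_const_bound[where B=1])
       (use S in \<open>auto intro: measurable_compose[OF S] split: split_indicator\<close>)
  have prob_b: "expectation (\<lambda>\<omega>. indicator {b} (S j \<omega>)) = pmf p b" for b
  proof -
    have "expectation (\<lambda>\<omega>. indicator {b} (S j \<omega>)) =
        integral\<^sup>L (distr M (count_space UNIV) (S j)) (indicator {b} :: _ \<Rightarrow> real)"
      by (subst integral_distr[OF S]) auto
    then show ?thesis unfolding law by (simp add: measure_pmf_single)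
  qed
  have prod: "integrable M (\<lambda>\<omega>. \<psi> (D \<omega>) b * indicator {b} (S j \<omega>)) \<and>
      expectation (\<lambda>\<omega>. \<psi> (D \<omega>) b * indicator {b} (S j \<omega>)) = expectation (\<lambda>\<omega>. \<psi> (D \<omega>) b) * pmf p b" for b
  proof -
    obtain h where h: "\<And>\<omega>. \<omega> \<in> space M \<Longrightarrow> \<psi> (D \<omega>) b = h (restrict (\<lambda>i. S i \<omega>) {..<j})"
      using determined_by_factor[OF determined_by_comp[OF det, where F = "\<lambda>d. \<psi> d b"]] by blast
    let ?A = "\<lambda>\<omega>. restrict (\<lambda>i. S i \<omega>) {..<j}"
    have "indep_var (PiM {..<j} (\<lambda>_. count_space UNIV)) ?A
        (PiM {j} (\<lambda>_. count_space UNIV)) (\<lambda>\<omega>. restrict (\<lambda>i. S i \<omega>) {j})"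
      by (rule indep_var_restrict[OF ind]) auto
    then have "indep_var borel (h \<circ> ?A) borel
        ((\<lambda>s. indicator {b} (s j) :: real) \<circ> (\<lambda>\<omega>. restrict (\<lambda>i. S i \<omega>) {j}))"
    proof (rule indep_var_compose)
      show "h \<in> borel_measurable (PiM {..<j} (\<lambda>_. count_space UNIV))"
        unfolding PiM_count_space_UNIV by simp
      show "(\<lambda>s. indicator {b} (s j) :: real) \<in> borel_measurable (PiM {j} (\<lambda>_. count_space UNIV))"
        by (rule measurable_compose[OF measurable_component_singleton[of j]]) auto
    qed
    then have iv: "indep_var borel (\<lambda>\<omega>. h (?A \<omega>)) borel (\<lambda>\<omega>. indicator {b} (S j \<omega>))"
      by (simp add: comp_def)
    have int_h: "integrable M (\<lambda>\<omega>. h (?A \<omega>))"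
      using int_past[of b] h Bochner_Integration.integrable_cong[OF refl, of M "\<lambda>\<omega>. \<psi> (D \<omega>) b" "\<lambda>\<omega>. h (?A \<omega>)"] by simp
    have "expectation (\<lambda>\<omega>. \<psi> (D \<omega>) b * indicator {b} (S j \<omega>)) =
        expectation (\<lambda>\<omega>. h (?A \<omega>) * indicator {b} (S j \<omega>))"
      using h by (intro Bochner_Integration.integral_cong) auto
    also have "\<dots> = expectation (\<lambda>\<omega>. h (?A \<omega>)) * pmf p b"
      using indep_var_lebesgue_integral[OF iv int_h int_ind] prob_b by simp
    also have "expectation (\<lambda>\<omega>. h (?A \<omega>)) = expectation (\<lambda>\<omega>. \<psi> (D \<omega>) b)"
      using h by (intro Bochner_Integration.integral_cong) auto
    finally show ?thesis
      using indep_var_integrable[OF iv int_h int_ind] h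
        Bochner_Integration.integrable_cong[OF refl, of M "\<lambda>\<omega>. \<psi> (D \<omega>) b * indicator {b} (S j \<omega>)"
          "\<lambda>\<omega>. h (?A \<omega>) * indicator {b} (S j \<omega>)"] by simp
  qed
  have "expectation (\<lambda>\<omega>. \<psi> (D \<omega>) (S j \<omega>)) =
      expectation (\<lambda>\<omega>. \<Sum>b\<in>UNIV. \<psi> (D \<omega>) b * indicator {b} (S j \<omega>))"
    by (intro Bochner_Integration.integral_cong refl) (simp add: indicator_def)
  also have "\<dots> = (\<Sum>b\<in>UNIV. expectation (\<lambda>\<omega>. \<psi> (D \<omega>) b) * pmf p b)"
    using prod by (subst Bochner_Integration.integral_sum) auto
  also have "\<dots> = expectation (\<lambda>\<omega>. \<Sum>b\<in>UNIV. \<psi> (D \<omega>) b * pmf p b)"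
    using int_past by (subst Bochner_Integration.integral_sum) auto
  also have "\<dots> = expectation (\<lambda>\<omega>. measure_pmf.expectation p (\<psi> (D \<omega>)))"
    by (subst integral_measure_pmf_real[of UNIV]) auto
  finally show ?thesis .
qed

section \<open>Linear recursions\<close>

lemma contraction_recursion_bound:
  fixes b :: "nat \<Rightarrow> real"
  assumes r: "0 < r" "r \<le> 1" and s: "0 \<le> s"
    and rec: "\<And>j. b (Suc j) \<le> (1 - r) * b j + s"
  shows "b k \<le> (1 - r) ^ k * b 0 + s / r"
proof (induction k)
  case 0
  then show ?case using r s by simp
next
  case (Suc k)
  have "b (Suc k) \<le> (1 - r) * ((1 - r) ^ k * b 0 + s / r) + s"
    using rec[of k] mult_left_mono[OF Suc.IH, of "1 - r"] r by linarith
  also have "\<dots> = (1 - r) ^ Suc k * b 0 + s / r"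
    using r by (simp add: field_simps)
  finally show ?case .
qed

lemma power_one_minus_le_exp:
  assumes "0 \<le> r" "r \<le> 1" shows "(1 - r) ^ k \<le> exp (- (r * real k))"
proof -
  have "(1 - r) ^ k \<le> exp (- r) ^ k"
    using exp_ge_add_one_self[of "- r"] assms by (intro power_mono) auto
  then show ?thesis by (simp add: exp_of_nat_mult[symmetric] mult.commute)
qed

section \<open>The lag-tolerant contraction\<close>

text \<open>
  One step at stale gradient point \<open>y\<close> and current point \<open>u\<close>, for a mean gradient \<open>g\<close> at \<open>y\<close> that is
  strongly monotone towards \<open>z\<close> and has components at most \<open>B\<close>; \<open>K\<close> bounds the \<open>\<ell>\<^sub>1\<close> distance from
  \<open>y\<close> to \<open>u\<close>.
\<close>

lemma stale_step_contraction:
  fixes u y z g :: "real ^ 'n"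
  assumes \<gamma>: "0 \<le> \<gamma>" and c: "0 \<le> c" and mono: "c * (norm (y - z))\<^sup>2 \<le> g \<bullet> (y - z)"
    and comp: "\<And>a. \<bar>g $ a\<bar> \<le> B" and l1: "(\<Sum>a\<in>UNIV. \<bar>(u - y) $ a\<bar>) \<le> K"
  shows "(norm (u - z))\<^sup>2 - 2 * \<gamma> * ((u - z) \<bullet> g)
    \<le> (1 - \<gamma> * c) * (norm (u - z))\<^sup>2 + 2 * \<gamma> * K * B + 2 * \<gamma> * c * K\<^sup>2"
proof -
  have B: "B \<ge> 0" using comp[of undefined] by linarith
  have "\<bar>(u - y) \<bullet> g\<bar> \<le> (\<Sum>a\<in>UNIV. \<bar>(u - y) $ a * g $ a\<bar>)"
    unfolding inner_vec_def by (simp only: inner_real_def) (rule sum_abs)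
  also have "\<dots> \<le> (\<Sum>a\<in>UNIV. \<bar>(u - y) $ a\<bar> * B)"
    unfolding abs_mult using comp by (intro sum_mono mult_left_mono) auto
  also have "\<dots> \<le> K * B"
    unfolding sum_distrib_right[symmetric] using l1 B by (rule mult_right_mono)
  finally have cross: "(u - y) \<bullet> g \<ge> - (K * B)" by linarith
  have "norm (u - y) \<le> K"
    using norm_le_l1_cart[of "u - y"] l1 by linarith
  then have "(norm (u - y))\<^sup>2 \<le> K\<^sup>2" by (intro power_mono) auto
  moreover have "(norm (u - z))\<^sup>2 \<le> 2 * (norm (y - z))\<^sup>2 + 2 * (norm (u - y))\<^sup>2"
  proof -
    have "norm (u - z) \<le> norm (y - z) + norm (u - y)"
      using norm_triangle_ineq[of "y - z" "u - y"] by simp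
    then have "(norm (u - z))\<^sup>2 \<le> (norm (y - z) + norm (u - y))\<^sup>2"
      by (intro power_mono) auto
    also have "\<dots> \<le> 2 * (norm (y - z))\<^sup>2 + 2 * (norm (u - y))\<^sup>2"
      using zero_le_power2[of "norm (y - z) - norm (u - y)"] by (simp add: power2_eq_square algebra_simps)
    finally show ?thesis .
  qed
  ultimately have "c * (norm (u - z))\<^sup>2 \<le> c * (2 * (norm (y - z))\<^sup>2 + 2 * K\<^sup>2)"
    using c by (intro mult_left_mono) auto
  then have "2 * ((u - z) \<bullet> g) \<ge> c * (norm (u - z))\<^sup>2 - 2 * c * K\<^sup>2 - 2 * (K * B)"
    using mono cross by (simp add: inner_diff_left inner_diff_right inner_commute algebra_simps)
  from mult_left_mono[OF this \<gamma>] show ?thesis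
    by (simp add: algebra_simps)
qed

text \<open>
  The assumption \<open>small\<close> forces \<open>\<gamma> * c \<le> \<Delta> / 4\<close>.  This makes the squared lag term of \<open>N\<close> small enough
  for the denominator of \<open>\<gamma>\<close>, in which the squared lag has only the weight \<open>4 * \<Omega> * sqrt \<Delta>\<close>.
\<close>

lemma stepsize_bounds:
  fixes L M \<Omega> \<Delta> \<rho> c \<theta> \<epsilon> \<gamma> t :: real
  assumes pos: "L > 0" "c > 0" "\<epsilon> > 0" "0 < \<theta>" "\<theta> < 1"
    and stat: "0 \<le> \<Omega>" "0 \<le> \<Delta>" "\<Delta> \<le> 1" "\<Delta> \<le> \<rho>" "0 \<le> t"
    and small: "2 * c\<^sup>2 * \<epsilon> < L * (\<Omega> * M\<^sup>2 * \<Delta>)"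
    and \<gamma>: "\<gamma> = \<theta> * \<epsilon> * c / (2 * L * M\<^sup>2 * \<Omega> * (1 + 6 * \<rho> * t + 4 * t\<^sup>2 * \<Omega> * sqrt \<Delta>))"
  defines "N \<equiv> \<Omega> * M\<^sup>2 * (1 + 2 * t * \<Delta>) + 2 * \<gamma> * c * t\<^sup>2 * \<Omega>\<^sup>2 * M\<^sup>2"
  shows "\<gamma> > 0" and "N \<ge> 0" and "L / 2 * (\<gamma> * N / c) \<le> \<epsilon> / 4"
    and "1 / (\<gamma> * c) \<le> 2 * L * M\<^sup>2 * \<Omega> * (1 + 6 * t * \<rho> + 6 * t\<^sup>2 * \<Omega> * sqrt \<Delta>) / (c\<^sup>2 * \<theta> * \<epsilon>)"
proof -
  define Q where "Q = 1 + 6 * \<rho> * t + 4 * t\<^sup>2 * \<Omega> * sqrt \<Delta>"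
  have "L * (\<Omega> * M\<^sup>2 * \<Delta>) > 0"
    using small pos by (intro less_trans[OF _ small]) auto
  then have "\<Omega> * M\<^sup>2 * \<Delta> \<noteq> 0" by auto
  then have \<Omega>: "\<Omega> > 0" and M: "M\<^sup>2 > 0" and \<Delta>: "\<Delta> > 0"
    using stat by (auto simp: less_le)
  have Q: "Q \<ge> 1" unfolding Q_def using stat by simp
  define R where "R = L * M\<^sup>2 * \<Omega>"
  have R: "R > 0" unfolding R_def using pos \<Omega> M by simp
  have \<gamma>_eq: "\<gamma> = \<theta> * \<epsilon> * c / (2 * R * Q)"
    unfolding \<gamma> Q_def R_def by (simp add: mult.assoc)
  show "\<gamma> > 0" unfolding \<gamma>_eq using pos R Q by simp
  have \<gamma>R: "\<gamma> * R * Q = \<theta> * \<epsilon> * c / 2"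
    unfolding \<gamma>_eq using R Q by (simp add: field_simps)
  have "(\<gamma> * c) * R \<le> (\<gamma> * c) * R * Q"
    using mult_left_mono[OF Q, of "\<gamma> * c * R"] R pos \<open>\<gamma> > 0\<close> by simp
  also have "\<dots> = \<theta> * (\<epsilon> * c\<^sup>2 / 2)"
    using \<gamma>R by (simp add: power2_eq_square field_simps)
  also have "\<dots> \<le> 1 * (\<epsilon> * c\<^sup>2 / 2)"
    using pos by (intro mult_right_mono) auto
  also have "\<dots> \<le> (\<Delta> / 4) * R"
    using small unfolding R_def by (simp add: field_simps)
  finally have \<gamma>c: "\<gamma> * c \<le> \<Delta> / 4"
    using R by simp
  show "N \<ge> 0"
    unfolding N_def using stat \<open>\<gamma> > 0\<close> pos by (intro add_nonneg_nonneg mult_nonneg_nonneg) auto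
  have "\<Delta> \<le> sqrt \<Delta>"
    using stat by (intro real_le_rsqrt) (simp add: power2_eq_square mult_left_le_one_le)
  then have "\<gamma> * c \<le> 2 * sqrt \<Delta>" using \<gamma>c \<Delta> by linarith
  then have "(t\<^sup>2 * \<Omega>) * (\<gamma> * c) \<le> (t\<^sup>2 * \<Omega>) * (2 * sqrt \<Delta>)"
    using \<Omega> by (intro mult_left_mono) auto
  moreover have "t * \<Delta> \<le> t * \<rho>" and "0 \<le> t * \<rho>"
    using stat by (auto intro: mult_left_mono)
  ultimately have "1 + 2 * t * \<Delta> + 2 * \<gamma> * c * t\<^sup>2 * \<Omega> \<le> Q"
    unfolding Q_def by (simp add: algebra_simps)
  then have "(\<Omega> * M\<^sup>2) * (1 + 2 * t * \<Delta> + 2 * \<gamma> * c * t\<^sup>2 * \<Omega>) \<le> (\<Omega> * M\<^sup>2) * Q"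
    using \<Omega> M by (intro mult_left_mono) auto
  then have "N \<le> (\<Omega> * M\<^sup>2) * Q"
    unfolding N_def by (simp add: algebra_simps power2_eq_square)
  then have "(\<gamma> * L) * N \<le> (\<gamma> * L) * ((\<Omega> * M\<^sup>2) * Q)"
    using \<open>\<gamma> > 0\<close> pos by (intro mult_left_mono) auto
  also have "\<dots> = \<theta> * (\<epsilon> * c / 2)"
    using \<gamma>R unfolding R_def by (simp add: algebra_simps)
  also have "\<dots> \<le> 1 * (\<epsilon> * c / 2)"
    using pos by (intro mult_right_mono) auto
  finally show "L / 2 * (\<gamma> * N / c) \<le> \<epsilon> / 4"
    using pos by (simp add: field_simps)
  have "Q \<le> 1 + 6 * t * \<rho> + 6 * t\<^sup>2 * \<Omega> * sqrt \<Delta>"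
    unfolding Q_def using stat by (simp add: algebra_simps)
  then have "2 * R * Q / (c\<^sup>2 * \<theta> * \<epsilon>) \<le>
      2 * R * (1 + 6 * t * \<rho> + 6 * t\<^sup>2 * \<Omega> * sqrt \<Delta>) / (c\<^sup>2 * \<theta> * \<epsilon>)"
    using R pos by (intro divide_right_mono mult_left_mono) auto
  moreover have "1 / (\<gamma> * c) = 2 * R * Q / (c\<^sup>2 * \<theta> * \<epsilon>)"
    unfolding \<gamma>_eq using pos R Q by (simp add: field_simps power2_eq_square)
  ultimately show "1 / (\<gamma> * c) \<le>
      2 * L * M\<^sup>2 * \<Omega> * (1 + 6 * t * \<rho> + 6 * t\<^sup>2 * \<Omega> * sqrt \<Delta>) / (c\<^sup>2 * \<theta> * \<epsilon>)"
    unfolding R_def by (simp add: mult.assoc)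
qed

text \<open>
  For \<open>a \<le> \<epsilon>\<close>, where the logarithm may be negative, no condition on \<open>k\<close> is needed.
\<close>

lemma transient_bound:
  assumes r: "0 < r" "r \<le> 1" and pos: "0 < \<epsilon>" "0 \<le> a" and k: "a > \<epsilon> \<Longrightarrow> real k \<ge> ln (a / \<epsilon>) / r"
  shows "(1 - r) ^ k * a \<le> \<epsilon>"
proof (cases "a > \<epsilon>")
  case True
  then have "ln (a / \<epsilon>) \<le> r * real k"
    using k r by (simp add: divide_le_eq mult.commute)
  then have "exp (- (r * real k)) \<le> exp (- ln (a / \<epsilon>))"
    by simp
  also have "\<dots> = \<epsilon> / a"
    using True pos by (simp add: exp_minus)
  finally have "(1 - r) ^ k \<le> \<epsilon> / a"
    using power_one_minus_le_exp[of r k] r by linarith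
  then show ?thesis using True pos by (simp add: le_divide_eq)
next
  case False
  have "(1 - r) ^ k * a \<le> 1 * a"
    using r pos by (intro mult_right_mono power_le_one) auto
  then show ?thesis using False by linarith
qed

section \<open>Convergence of the asynchronous iteration\<close>

theorem proposition4p1:
  fixes E :: "('n::finite) set set"
    and X :: "(real ^ 'n) set"
    and fe :: "'n set \<Rightarrow> real ^ 'n \<Rightarrow> real"
    and f :: "real ^ 'n \<Rightarrow> real"
    and gradf :: "real ^ 'n \<Rightarrow> real ^ 'n"
    and G :: "'n set \<Rightarrow> real ^ 'n \<Rightarrow> real ^ 'n"
    and xstar x0 :: "real ^ 'n"
    and L c M \<gamma> \<theta> \<epsilon> D\<^sub>0 :: real
    and P :: "'w measure"
    and edge :: "nat \<Rightarrow> 'w \<Rightarrow> 'n set"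
    and comp :: "nat \<Rightarrow> 'w \<Rightarrow> 'n"
    and x :: "nat \<Rightarrow> 'w \<Rightarrow> real ^ 'n"
    and stale :: "nat \<Rightarrow> nat"
    and \<tau> k :: nat
  assumes E_nonempty: "E \<noteq> {}"
    and edges_nonempty: "{} \<notin> E"
    and fe_local: "\<And>e. e \<in> E \<Longrightarrow> depends_only_on X e (fe e)"
    and f_sum: "\<And>y. y \<in> X \<Longrightarrow> f y = (\<Sum>e\<in>E. fe e y)"
    and fe_convex: "\<And>e. e \<in> E \<Longrightarrow> convex_on X (fe e)"
    and f_grad: "\<And>y. y \<in> X \<Longrightarrow> (f has_derivative (\<lambda>h. gradf y \<bullet> h)) (at y within X)"
    and gradf_cont: "continuous_on X gradf"
    and gradf_lipschitz: "\<And>y y'. y \<in> X \<Longrightarrow> y' \<in> X \<Longrightarrow>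
           norm (gradf y' - gradf y) \<le> L * norm (y' - y)"
    and c_pos: "c > 0"
    and f_strongly_convex: "\<And>y y'. y \<in> X \<Longrightarrow> y' \<in> X \<Longrightarrow>
           f y' \<ge> f y + (y' - y) \<bullet> gradf y + c / 2 * (norm (y' - y))\<^sup>2"
    and xstar_min: "is_arg_min f (\<lambda>y. y \<in> X) xstar"
    and xstar_interior: "xstar \<in> interior X"
    and G_subgrad: "\<And>e y. e \<in> E \<Longrightarrow> y \<in> X \<Longrightarrow>
           (1 / real (card E)) *\<^sub>R G e y \<in> subdifferential X (fe e) y"
    and G_local: "\<And>e. e \<in> E \<Longrightarrow> depends_only_on X e (G e)"
    and G_support: "\<And>e y v. e \<in> E \<Longrightarrow> y \<in> X \<Longrightarrow> v \<notin> e \<Longrightarrow> G e y $ v = 0"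
    and G_bounded: "\<And>y. y \<in> X \<Longrightarrow> AE e in measure_pmf (pmf_of_set E). norm (G e y) \<le> M"
    and step_c: "\<gamma> * c < 1"
    and prob: "prob_space P"
    and samples_indep: "prob_space.indep_vars P (\<lambda>_. count_space UNIV)
           (\<lambda>j \<omega>. (edge j \<omega>, comp j \<omega>)) (UNIV :: nat set)"
    and samples_law: "\<And>j. distr P (count_space UNIV) (\<lambda>\<omega>. (edge j \<omega>, comp j \<omega>))
           = measure_pmf (sample_pmf E)"
    and x0_in_X: "x0 \<in> X"
    and x_init: "\<And>\<omega>. \<omega> \<in> space P \<Longrightarrow> x 0 \<omega> = x0"
    and x_update: "\<And>j \<omega>. \<omega> \<in> space P \<Longrightarrow>
           x (Suc j) \<omega> = x j \<omega> - (\<gamma> * real (card (edge j \<omega>))) *\<^sub>R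
             (coord_proj (comp j \<omega>) *v G (edge j \<omega>) (x (stale j) \<omega>))"
    and x_in_X: "\<And>j. AE \<omega> in P. x j \<omega> \<in> X"
    and stale_le: "\<And>j. stale j \<le> j"
    and lag_le: "\<And>j. j - stale j \<le> \<tau>"
    and eps_pos: "\<epsilon> > 0"
    and theta: "0 < \<theta>" "\<theta> < 1"
    and gamma_eq: "\<gamma> = \<theta> * \<epsilon> * c /
           (2 * L * M\<^sup>2 * real (hyp_Omega E) *
             (1 + 6 * hyp_rho E * real \<tau>
                + 4 * (real \<tau>)\<^sup>2 * real (hyp_Omega E) * sqrt (hyp_Delta E)))"
    and D0_eq: "D\<^sub>0 = (norm (x0 - xstar))\<^sup>2"
    and k_ge: "real k \<ge>
           2 * L * M\<^sup>2 * real (hyp_Omega E) *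
             (1 + 6 * real \<tau> * hyp_rho E
                + 6 * (real \<tau>)\<^sup>2 * real (hyp_Omega E) * sqrt (hyp_Delta E))
             * ln (L * D\<^sub>0 / \<epsilon>)
           / (c\<^sup>2 * \<theta> * \<epsilon>)"
  shows "prob_space.expectation P (\<lambda>\<omega>. f (x k \<omega>) - f xstar) \<le> \<epsilon>"
proof -
  interpret prob_space P by (rule prob)
  define S where "S = (\<lambda>j \<omega>. (edge j \<omega>, comp j \<omega>))"
  define \<Omega> where "\<Omega> = real (hyp_Omega E)"
  define \<Delta> where "\<Delta> = hyp_Delta E"
  define g where "g y = edge_mean E (\<lambda>e. G e y)" for y
  have convX: "convex X"
    using E_nonempty fe_convex unfolding convex_on_def by blast
  have xsX: "xstar \<in> X" using xstar_interior interior_subset by blast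
  have bound: "norm (G e y) \<le> M" if "e \<in> E" "y \<in> X" for e y
    using G_bounded[OF that(2)] that(1) E_nonempty by (simp add: AE_measure_pmf_iff)
  have M: "M \<ge> 0"
    using bound[OF _ x0_in_X] E_nonempty norm_ge_zero order_trans by blast
  have grad0: "gradf xstar = 0"
    by (rule gradient_zero_at_interior_minimizer[OF xstar_min xstar_interior f_grad[OF xsX]])
  have upper: "f y - f xstar \<le> L / 2 * (norm (y - xstar))\<^sup>2" if "y \<in> X" for y
    using lipschitz_gradient_upper_bound[OF convX xsX that f_grad, where L = L]
      gradf_lipschitz[OF xsX] grad0 by simp
  \<comment> \<open>The two halves of the modulus come from strong convexity at \<open>y\<close> and at the minimizer.\<close>
  have mono: "c * (norm (y - xstar))\<^sup>2 \<le> g y \<bullet> (y - xstar)" if y: "y \<in> X" for y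
  proof -
    have "g y \<in> subdifferential X f y"
      unfolding g_def using f_sum y G_subgrad by (intro edge_mean_subgradient)
    then have "f xstar \<ge> f y + g y \<bullet> (xstar - y) + c / 2 * (norm (xstar - y))\<^sup>2"
      using f_strongly_convex by (intro strongly_convex_subgradient[OF convX y xsX]) auto
    moreover have "f y \<ge> f xstar + c / 2 * (norm (y - xstar))\<^sup>2"
      using f_strongly_convex[OF xsX y] grad0 by simp
    ultimately show ?thesis
      by (simp add: norm_minus_commute inner_diff_right)
  qed
  have comp_bound: "\<bar>g y $ a\<bar> \<le> M * \<Delta>" if "y \<in> X" for y a
    unfolding g_def \<Delta>_def using E_nonempty G_support bound that
    by (intro edge_mean_component_bound) auto
  have radius: "c\<^sup>2 * (norm (y - xstar))\<^sup>2 \<le> \<Omega> * M\<^sup>2 * \<Delta>" if y: "y \<in> X" for y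
  proof -
    have "c * (norm (y - xstar))\<^sup>2 \<le> norm (g y) * norm (y - xstar)"
      using mono[OF y] norm_cauchy_schwarz order_trans by blast
    then have "c * norm (y - xstar) \<le> norm (g y)"
      by (cases "y = xstar") (simp_all add: power2_eq_square mult.assoc[symmetric])
    then have "(c * norm (y - xstar))\<^sup>2 \<le> (norm (g y))\<^sup>2"
      using c_pos by (intro power_mono) auto
    also have "\<dots> \<le> \<Omega> * M\<^sup>2 * \<Delta>"
      unfolding g_def \<Omega>_def \<Delta>_def using E_nonempty G_support bound y
      by (intro norm_edge_mean_bound) auto
    finally show ?thesis by (simp add: power_mult_distrib)
  qed

  have S_ind: "indep_vars (\<lambda>_. count_space UNIV) S UNIV"
    using samples_indep unfolding S_def .
  then have S_meas: "S j \<in> measurable P (count_space UNIV)" for j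
    unfolding indep_vars_def by auto
  have S_law: "distr P (count_space UNIV) (S j) = measure_pmf (sample_pmf E)" for j
    unfolding S_def by (rule samples_law)
  have det: "determined_by P S j (x j)" for j
  proof (induction j rule: less_induct)
    case (less j)
    show ?case
    proof (cases j)
      case 0
      then show ?thesis using x_init by (simp add: determined_by_def)
    next
      case (Suc i)
      have "x j \<omega> = x j \<omega>'"
        if \<omega>: "\<omega> \<in> space P" "\<omega>' \<in> space P" and eq: "\<And>l. l < j \<Longrightarrow> S l \<omega> = S l \<omega>'" for \<omega> \<omega>'
      proof -
        have same: "x l \<omega> = x l \<omega>'" if "l \<le> i" for l
        proof -
          have "determined_by P S l (x l)" using less.IH[of l] Suc that by simp
          moreover have "\<forall>m<l. S m \<omega> = S m \<omega>'" using eq Suc that by simp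
          ultimately show ?thesis using \<omega> unfolding determined_by_def by blast
        qed
        have "edge i \<omega> = edge i \<omega>'" "comp i \<omega> = comp i \<omega>'"
          using eq[of i] Suc unfolding S_def by simp_all
        then show ?thesis
          unfolding Suc x_update[OF \<omega>(1)] x_update[OF \<omega>(2)]
          using same[of i] same[OF stale_le[of i]] by simp
      qed
      then show ?thesis unfolding determined_by_def by blast
    qed
  qed
  have int_x: "integrable P (\<lambda>\<omega>. F (x j \<omega>))" for F :: "real ^ 'n \<Rightarrow> real" and j
    by (rule integrable_determined_by[OF S_meas determined_by_comp[OF det]])
  have AE_edge: "AE \<omega> in P. edge j \<omega> \<in> E" for j
  proof -
    have "set_pmf (sample_pmf E) \<subseteq> {s. fst s \<in> E}"
      using E_nonempty unfolding sample_pmf_def by (auto simp: set_bind_pmf)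
    then have "AE s in measure_pmf (sample_pmf E). fst s \<in> E"
      by (auto simp: AE_measure_pmf_iff)
    then have "AE s in distr P (count_space UNIV) (S j). fst s \<in> E"
      unfolding S_law .
    from AE_distrD[OF S_meas this] show ?thesis unfolding S_def by simp
  qed
  have AE_path: "AE \<omega> in P. \<forall>j. x j \<omega> \<in> X \<and> edge j \<omega> \<in> E"
    unfolding AE_all_countable using x_in_X AE_edge by auto

  show ?thesis
  proof (cases "L \<le> 0 \<or> L * (\<Omega> * M\<^sup>2 * \<Delta>) \<le> 2 * c\<^sup>2 * \<epsilon>")
    case True
    \<comment> \<open>Here no point of the domain has a value gap above \<open>\<epsilon>\<close>.\<close>
    have gap: "f y - f xstar \<le> \<epsilon>" if y: "y \<in> X" for y
    proof (cases "L \<le> 0")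
      case True
      then have "L / 2 * (norm (y - xstar))\<^sup>2 \<le> 0" by (simp add: mult_nonpos_nonneg)
      then show ?thesis using upper[OF y] eps_pos by linarith
    next
      case False
      then have "L * (c\<^sup>2 * (norm (y - xstar))\<^sup>2) \<le> L * (\<Omega> * M\<^sup>2 * \<Delta>)"
        using radius[OF y] by (intro mult_left_mono) auto
      then have "L * (c\<^sup>2 * (norm (y - xstar))\<^sup>2) \<le> 2 * c\<^sup>2 * \<epsilon>"
        using False \<open>L \<le> 0 \<or> _\<close> by linarith
      then have "c\<^sup>2 * (L / 2 * (norm (y - xstar))\<^sup>2) \<le> c\<^sup>2 * \<epsilon>"
        by (simp add: algebra_simps)
      then show ?thesis using upper[OF y] c_pos by simp
    qed
    show ?thesis
      using x_in_X[of k] gap by (intro integral_le_const int_x[of "\<lambda>y. f y - f xstar"]) auto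
  next
    case False
    \<comment> \<open>Now \<open>\<epsilon>\<close> is small compared with the largest possible value gap, which bounds \<open>\<gamma> * c\<close>.\<close>
    define N where
      "N = \<Omega> * M\<^sup>2 * (1 + 2 * real \<tau> * \<Delta>) + 2 * \<gamma> * c * (real \<tau>)\<^sup>2 * \<Omega>\<^sup>2 * M\<^sup>2"
    have L: "L > 0" and small: "2 * c\<^sup>2 * \<epsilon> < L * (\<Omega> * M\<^sup>2 * \<Delta>)"
      using False by auto
    have stat: "0 \<le> \<Omega>" "0 \<le> \<Delta>" "\<Delta> \<le> 1" "\<Delta> \<le> hyp_rho E" "0 \<le> real \<tau>"
      unfolding \<Omega>_def \<Delta>_def by (simp_all add: hyp_Delta_nonneg hyp_Delta_le_1 hyp_Delta_le_hyp_rho)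
    note step = stepsize_bounds[OF L c_pos eps_pos theta stat small
        gamma_eq[folded \<Omega>_def \<Delta>_def], folded N_def]
    have r: "0 < \<gamma> * c" "\<gamma> * c \<le> 1"
      using step(1) c_pos step_c by simp_all
    define b where "b j = expectation (\<lambda>\<omega>. (norm (x j \<omega> - xstar))\<^sup>2)" for j
    have rec: "b (Suc j) \<le> (1 - \<gamma> * c) * b j + \<gamma>\<^sup>2 * N" for j
    proof -
      define \<psi> where "\<psi> = (\<lambda>(u, y) (e, v).
        (norm (u - xstar - (\<gamma> * real (card e)) *\<^sub>R (coord_proj v *v G e y)))\<^sup>2)"
      define D where "D = (\<lambda>\<omega>. (x j \<omega>, x (stale j) \<omega>))"
      have det_D: "determined_by P S j D"
        unfolding D_def
        by (rule determined_by_Pair[OF det determined_by_mono[OF stale_le det]])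
      have "b (Suc j) = expectation (\<lambda>\<omega>. \<psi> (D \<omega>) (S j \<omega>))"
        unfolding b_def \<psi>_def D_def S_def
        by (intro Bochner_Integration.integral_cong refl) (simp add: x_update algebra_simps)
      also have "\<dots> = expectation (\<lambda>\<omega>. measure_pmf.expectation (sample_pmf E) (\<psi> (D \<omega>)))"
        by (rule expectation_fresh_sample[OF S_ind S_law det_D])
      also have "\<dots> \<le> expectation (\<lambda>\<omega>. (1 - \<gamma> * c) * (norm (x j \<omega> - xstar))\<^sup>2 + \<gamma>\<^sup>2 * N)"
      proof (rule integral_mono_AE)
        show "integrable P (\<lambda>\<omega>. measure_pmf.expectation (sample_pmf E) (\<psi> (D \<omega>)))"
          by (rule integrable_determined_by[OF S_meas determined_by_comp[OF det_D]])
        show "integrable P (\<lambda>\<omega>. (1 - \<gamma> * c) * (norm (x j \<omega> - xstar))\<^sup>2 + \<gamma>\<^sup>2 * N)"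
          by (rule int_x)
        show "AE \<omega> in P. measure_pmf.expectation (sample_pmf E) (\<psi> (D \<omega>))
            \<le> (1 - \<gamma> * c) * (norm (x j \<omega> - xstar))\<^sup>2 + \<gamma>\<^sup>2 * N"
          using AE_path AE_space
        proof eventually_elim
          case (elim \<omega>)
          define u y where "u = x j \<omega>" and "y = x (stale j) \<omega>"
          have yX: "y \<in> X" using elim unfolding y_def by blast
          define K where "K = \<gamma> * real \<tau> * (\<Omega> * M)"
          have "(\<Sum>a\<in>UNIV. \<bar>(u - y) $ a\<bar>) \<le> \<gamma> * real (j - stale j) * (\<Omega> * M)"
            unfolding u_def y_def \<Omega>_def using elim step(1) stale_le bound
            by (intro l1_displacement_bound[where e = "\<lambda>l. edge l \<omega>" and v = "\<lambda>l. comp l \<omega>"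
                  and W = "\<lambda>l. G (edge l \<omega>) (x (stale l) \<omega>)"] x_update) auto
          also have "\<dots> \<le> K"
            unfolding K_def using lag_le[of j] step(1) stat M
            by (intro mult_right_mono mult_left_mono) auto
          finally have l1: "(\<Sum>a\<in>UNIV. \<bar>(u - y) $ a\<bar>) \<le> K" .
          have "measure_pmf.expectation (sample_pmf E) (\<psi> (D \<omega>)) \<le>
              (norm (u - xstar))\<^sup>2 - 2 * \<gamma> * ((u - xstar) \<bullet> g y) + \<gamma>\<^sup>2 * (\<Omega> * M\<^sup>2)"
            unfolding \<psi>_def D_def g_def \<Omega>_def prod.case u_def[symmetric] y_def[symmetric]
            using E_nonempty edges_nonempty G_support bound yX
            by (intro expected_squared_distance_after_step) auto
          also have "\<dots> \<le> (1 - \<gamma> * c) * (norm (u - xstar))\<^sup>2 + 2 * \<gamma> * K * (M * \<Delta>)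
              + 2 * \<gamma> * c * K\<^sup>2 + \<gamma>\<^sup>2 * (\<Omega> * M\<^sup>2)"
            using stale_step_contraction[OF _ _ mono[OF yX] comp_bound[OF yX] l1, of \<gamma>] step(1) c_pos
            by simp
          also have "\<dots> = (1 - \<gamma> * c) * (norm (u - xstar))\<^sup>2 + \<gamma>\<^sup>2 * N"
            unfolding K_def N_def by (simp add: algebra_simps power2_eq_square)
          finally show ?case unfolding u_def .
        qed
      qed
      also have "\<dots> = (1 - \<gamma> * c) * b j + \<gamma>\<^sup>2 * N"
        unfolding b_def using int_x[of "\<lambda>y. (norm (y - xstar))\<^sup>2" j] by (simp add: prob_space)
      finally show ?thesis .
    qed
    have b0: "b 0 = D\<^sub>0"
    proof -
      have "b 0 = expectation (\<lambda>\<omega>. D\<^sub>0)"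
        unfolding b_def D0_eq using x_init by (intro Bochner_Integration.integral_cong) auto
      then show ?thesis by (simp add: prob_space)
    qed
    have "b k \<le> (1 - \<gamma> * c) ^ k * D\<^sub>0 + \<gamma>\<^sup>2 * N / (\<gamma> * c)"
      using contraction_recursion_bound[where b = b, OF r _ rec, of k] step(2) b0 by simp
    then have "L / 2 * b k \<le> L / 2 * ((1 - \<gamma> * c) ^ k * D\<^sub>0 + \<gamma>\<^sup>2 * N / (\<gamma> * c))"
      using L by (intro mult_left_mono) auto
    also have "\<dots> = (1 - \<gamma> * c) ^ k * (L * D\<^sub>0) / 2 + L / 2 * (\<gamma> * N / c)"
      using step(1) c_pos by (simp add: field_simps power2_eq_square)
    also have "\<dots> \<le> \<epsilon> / 2 + \<epsilon> / 4"
    proof (intro add_mono step(3) divide_right_mono transient_bound[OF r eps_pos])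
      show "0 \<le> L * D\<^sub>0" using L D0_eq by simp
      assume "\<epsilon> < L * D\<^sub>0"
      then have "ln (L * D\<^sub>0 / \<epsilon>) \<ge> 0" using eps_pos by simp
      from mult_right_mono[OF step(4) this] k_ge
      show "real k \<ge> ln (L * D\<^sub>0 / \<epsilon>) / (\<gamma> * c)"
        unfolding \<Omega>_def \<Delta>_def by (simp add: mult_ac)
    qed simp
    finally have bk: "L / 2 * b k \<le> \<epsilon>" using eps_pos by linarith
    have "expectation (\<lambda>\<omega>. f (x k \<omega>) - f xstar)
        \<le> expectation (\<lambda>\<omega>. L / 2 * (norm (x k \<omega> - xstar))\<^sup>2)"
      using x_in_X[of k] upper
      by (intro integral_mono_AE int_x[of "\<lambda>y. f y - f xstar"] int_x[of "\<lambda>y. L / 2 * (norm (y - xstar))\<^sup>2"])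
         auto
    also have "\<dots> = L / 2 * b k" unfolding b_def by simp
    finally show ?thesis using bk by linarith
  qed
qed

end
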